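(* Let $\alpha>0$, $\lambda\in\mathbb{R}$, let $r\ge 0$ be an integer, and let $X_{\lambda,r}$ be the $r$-truncated degenerate Poisson random variable with parameter $\alpha$. For every integer $n\ge 0$, we have $$E[X_{\lambda,r}^{n}]=\frac{e_{\lambda}(\alpha)}{e_{\lambda}(\alpha)-e_{\lambda,r}(\alpha)}\left(\mathrm{Bel}_{n,\lambda}(\alpha)-e_{\lambda}^{-1}(\alpha)\sum_{m=0}^{r}\frac{\alpha^{m}}{m!}(1)_{m,\lambda}\,m^{n}\right),$$ where $0^0=1$.
   Context: For $\lambda,x\in\mathbb{R}$ put $(x)_{0,\lambda}=1$ and $(x)_{n,\lambda}=x(x-\lambda)(x-2\lambda)\cdots(x-(n-1)\lambda)$ for $n\ge 1$. The degenerate exponential function is $e_{\lambda}(t)=(1+\lambda t)^{1/\lambda}=\sum_{k=0}^{\infty}(1)_{k,\lambda}\frac{t^k}{k!}$ (for $\lambda=0$, $e_0(t)=e^t$), and $e_{\lambda}^{-1}(t)=(1+\lambda t)^{-1/\lambda}=1/e_{\lambda}(t)$. For an integer $r\ge 0$, $e_{\lambda,r}(t)=\sum_{k=0}^{r}(1)_{k,\lambda}\frac{t^k}{k!}$. The degenerate Bell polynomials $\mathrm{Bel}_{n,\lambda}(x)$, $n\ge 0$, are defined by the generating function (power series expansion in $t$ around $t=0$) $$e_{\lambda}^{-1}(x)\,e_{\lambda}(xe^{t})=\sum_{n=0}^{\infty}\mathrm{Bel}_{n,\lambda}(x)\frac{t^{n}}{n!}.$$ The $r$-truncated degenerate Poisson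 random variable with parameter $\alpha>0$ is the random variable $X_{\lambda,r}$ taking values in $\{r+1,r+2,\dots\}$ with probability mass function $$p_{\lambda,r}(k)=P\{X_{\lambda,r}=k\}=\frac{(1)_{k,\lambda}}{e_{\lambda}(\alpha)-e_{\lambda,r}(\alpha)}\,\frac{\alpha^k}{k!},\qquad k=r+1,r+2,\dots.$$ To say that $X_{\lambda,r}$ is such a random variable presupposes that $\lambda,\alpha,r$ are such that this is a probability mass function: the series $\sum_k (1)_{k,\lambda}\alpha^k/k!$ converges to $e_\lambda(\alpha)$, the denominator $e_{\lambda}(\alpha)-e_{\lambda,r}(\alpha)$ is nonzero, and all values $p_{\lambda,r}(k)$ are nonnegative (so that they sum to $1$). *)

theory Defs
  imports "HOL-Probability.Probability" "HOL-Complex_Analysis.Complex_Analysis"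
begin

definition degenerate_ffact :: "real \<Rightarrow> real \<Rightarrow> nat \<Rightarrow> real" where
  "degenerate_ffact lam x n = (\<Prod>i<n. x - real i * lam)"

(* The formula (1 + lam t)^(1/lam) is meant for 1 + lam t > 0; outside that domain the value
   is whatever powr returns. *)
definition degenerate_exp :: "real \<Rightarrow> real \<Rightarrow> real" where
  "degenerate_exp lam t = (if lam = 0 then exp t else (1 + lam * t) powr (1 / lam))"

definition degenerate_exp_trunc :: "real \<Rightarrow> nat \<Rightarrow> real \<Rightarrow> real" where
  "degenerate_exp_trunc lam r t = (\<Sum>k\<le>r. degenerate_ffact lam 1 k * t ^ k / fact k)"

(* The sequence B is determined by the requirement that the generating function
   t \<mapsto> e_lam(x)^(-1) * e_lam(x e^t) has, near t = 0, the convergent expansion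
   \<Sum>n. B n * t^n / n!.  By degenerate_bell_ex1 below, there is exactly one
   such B whenever 1 + lam x > 0. *)
definition degenerate_bell :: "real \<Rightarrow> nat \<Rightarrow> real \<Rightarrow> real" where
  "degenerate_bell lam n x =
     (THE B. (\<lambda>t. inverse (degenerate_exp lam x) * degenerate_exp lam (x * exp t))
               has_fps_expansion Abs_fps (\<lambda>n. B n / fact n)) n"

definition trunc_degenerate_poisson_mass :: "real \<Rightarrow> nat \<Rightarrow> real \<Rightarrow> nat \<Rightarrow> real" where
  "trunc_degenerate_poisson_mass lam r \<alpha> k =
     degenerate_ffact lam 1 k / (degenerate_exp lam \<alpha> - degenerate_exp_trunc lam r \<alpha>)
       * (\<alpha> ^ k / fact k)"

(* The first three conjuncts are the conditions on the parameters under which the mass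
   function on {r+1, r+2, ...} is a probability mass function.  They leave only lam = 0,
   1 / lam a positive integer > r, or lam < 0 with \<bar>lam * \<alpha>\<bar> < 1; in each case
   1 + lam * \<alpha> > 0. *)
definition trunc_degenerate_poisson_rv ::
    "'a measure \<Rightarrow> ('a \<Rightarrow> nat) \<Rightarrow> real \<Rightarrow> nat \<Rightarrow> real \<Rightarrow> bool" where
  "trunc_degenerate_poisson_rv M X lam r \<alpha> \<longleftrightarrow>
     (\<lambda>k. degenerate_ffact lam 1 k * \<alpha> ^ k / fact k) sums degenerate_exp lam \<alpha> \<and>
     degenerate_exp lam \<alpha> - degenerate_exp_trunc lam r \<alpha> \<noteq> 0 \<and>
     (\<forall>k\<ge>r+1. trunc_degenerate_poisson_mass lam r \<alpha> k \<ge> 0) \<and>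
     X \<in> measurable M (count_space UNIV) \<and>
     (\<forall>\<omega>\<in>space M. X \<omega> \<in> {r+1..}) \<and>
     (\<forall>k\<ge>r+1. measure M {\<omega>\<in>space M. X \<omega> = k} = trunc_degenerate_poisson_mass lam r \<alpha> k)"

lemma eval_fps_zero_imp_zero:
  fixes f :: "real fps"
  assumes "fps_conv_radius f > 0" "eventually (\<lambda>z. eval_fps f z = 0) (nhds 0)"
  shows "fps_nth f n = 0"
  using assms
proof (induction n arbitrary: f)
  case 0
  from eventually_nhds_x_imp_x[OF 0(2)] show ?case by (simp add: eval_fps_at_0)
next
  case (Suc n f)
  have 1: "eventually (\<lambda>z::real. z \<in> eball 0 (fps_conv_radius f)) (nhds 0)"
    using Suc.prems by (intro eventually_nhds_in_open) (auto simp: zero_ereal_def)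
  have 2: "eventually (\<lambda>z. eventually (\<lambda>z. eval_fps f z = 0) (nhds z)) (nhds 0)"
    using Suc.prems(2) by (simp add: eventually_eventually)
  from 1 2 have "eventually (\<lambda>z. eval_fps (fps_deriv f) z = 0) (nhds 0)"
  proof eventually_elim
    case (elim z)
    then have "eval_fps (fps_deriv f) z = deriv (eval_fps f) z" by (simp add: eval_fps_deriv)
    also have "\<dots> = deriv (\<lambda>_. 0) z" by (rule deriv_cong_ev[OF elim(2) refl])
    finally show ?case by simp
  qed
  moreover have "fps_conv_radius (fps_deriv f) > 0"
    using Suc.prems(1) fps_conv_radius_deriv[of f] by order
  ultimately have "fps_nth (fps_deriv f) n = 0" by (rule Suc.IH[rotated])
  then show ?case by (simp del: of_nat_Suc)
qed

lemma has_fps_expansion_unique_real: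
  fixes f :: "real \<Rightarrow> real"
  assumes "f has_fps_expansion F" "f has_fps_expansion G"
  shows "F = G"
proof -
  have "(\<lambda>x. f x - f x) has_fps_expansion F - G"
    by (rule has_fps_expansion_diff[OF assms])
  then have "fps_nth (F - G) n = 0" for n
    by (intro eval_fps_zero_imp_zero) (auto simp: has_fps_expansion_def)
  then show ?thesis by (simp add: fps_eq_iff)
qed

lemma has_fps_expansion_Re:
  fixes g :: "complex \<Rightarrow> complex"
  assumes "g has_fps_expansion F"
  shows "(\<lambda>t. Re (g (of_real t))) has_fps_expansion Abs_fps (\<lambda>n. Re (fps_nth F n))"
  (is "_ has_fps_expansion ?R")
proof -
  have pos: "fps_conv_radius F > 0" and ev: "eventually (\<lambda>z. eval_fps F z = g z) (nhds 0)"
    using assms by (auto simp: has_fps_expansion_def)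
  have "fps_conv_radius F \<le> fps_conv_radius ?R"
    unfolding fps_conv_radius_def
  proof (rule conv_radius_geI_ex')
    fix r :: real assume "0 < r" "ereal r < conv_radius (fps_nth F)"
    then have "summable (\<lambda>n. fps_nth F n * of_real r ^ n)"
      by (intro summable_in_conv_radius) auto
    then have "summable (\<lambda>n. Re (fps_nth F n * of_real r ^ n))"
      by (rule summable_Re)
    then show "summable (\<lambda>n. fps_nth (Abs_fps (\<lambda>n. Re (fps_nth F n))) n * of_real r ^ n)"
      by (simp flip: of_real_power)
  qed
  moreover have "eventually (\<lambda>t. eval_fps ?R t = Re (g (of_real t))) (nhds 0)"
  proof -
    have fl: "filterlim complex_of_real (nhds 0) (nhds 0)"
      using tendsto_of_real[OF tendsto_ident_at, of 0 UNIV] 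
      by (metis continuous_of_real continuous_ident isCont_def of_real_0 tendsto_nhds_iff tendsto_of_real filterlim_ident)
    have "eventually (\<lambda>z. z \<in> eball 0 (fps_conv_radius F)) (nhds 0)"
      using pos by (intro eventually_nhds_in_open) (auto simp: zero_ereal_def)
    from eventually_conj[OF this ev] 
    have "eventually (\<lambda>t. complex_of_real t \<in> eball 0 (fps_conv_radius F) \<and> 
            eval_fps F (of_real t) = g (of_real t)) (nhds 0)"
      using fl unfolding filterlim_iff by blast
    then show ?thesis
    proof eventually_elim
      case (elim t)
      then have "(\<lambda>n. fps_nth F n * of_real t ^ n) sums eval_fps F (of_real t)"
        by (intro sums_eval_fps) auto
      then have "(\<lambda>n. Re (fps_nth F n * of_real t ^ n)) sums Re (eval_fps F (of_real t))"
        by (rule sums_Re)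
      then have "(\<lambda>n. Re (fps_nth F n) * t ^ n) sums Re (eval_fps F (of_real t))"
        by (simp flip: of_real_power)
      then show ?case using elim by (simp add: eval_fps_def sums_iff)
    qed
  qed
  ultimately show ?thesis using pos by (auto simp: has_fps_expansion_def)
qed

lemma degenerate_bell_ex1:
  assumes "1 + lam * x > 0"
  shows "\<exists>!B. (\<lambda>t. inverse (degenerate_exp lam x) * degenerate_exp lam (x * exp t))
               has_fps_expansion Abs_fps (\<lambda>n. B n / fact n)"
proof -
  let ?f = "\<lambda>t. inverse (degenerate_exp lam x) * degenerate_exp lam (x * exp t)"
  define h where "h = (\<lambda>z::complex. if lam = 0 then exp (of_real x * exp z)
       else (1 + of_real lam * of_real x * exp z) powr (of_real (1/lam)))"
  define g where "g = (\<lambda>z. of_real (inverse (degenerate_exp lam x)) * h z)"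
  have "h analytic_on {0}"
  proof (cases "lam = 0")
    case False
    have "1 + of_real lam * of_real x * exp (0::complex) = of_real (1 + lam * x)" by simp
    then have "1 + of_real lam * of_real x * exp (0::complex) \<notin> \<real>\<^sub>\<le>\<^sub>0"
      using assms by (metis complex_nonpos_Reals_iff Re_complex_of_real not_le)
    with False show ?thesis unfolding h_def by (auto intro!: analytic_intros)
  qed (auto simp: h_def intro!: analytic_intros)
  then have "g analytic_on {0}" unfolding g_def by (intro analytic_intros)
  then have "g has_fps_expansion fps_expansion g 0"
    by (rule analytic_at_imp_has_fps_expansion_0)
  from has_fps_expansion_Re[OF this]
  have R: "(\<lambda>t. Re (g (of_real t))) has_fps_expansion
      Abs_fps (\<lambda>n. Re (fps_nth (fps_expansion g 0) n))" .
  have "((\<lambda>t. 1 + lam * (x * exp t)) \<longlongrightarrow> 1 + lam * (x * exp 0)) (nhds 0)"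
    by (intro tendsto_intros filterlim_ident)
  then have "eventually (\<lambda>t. 1 + lam * (x * exp t) > 0) (nhds 0)"
    using assms by (intro order_tendstoD(1)) auto
  then have "eventually (\<lambda>t. Re (g (of_real t)) = ?f t) (nhds 0)"
  proof eventually_elim
    case (elim t)
    have "h (of_real t) = of_real (degenerate_exp lam (x * exp t))"
    proof (cases "lam = 0")
      case True
      then show ?thesis by (simp add: h_def degenerate_exp_def flip: exp_of_real)
    next
      case False
      have "1 + of_real lam * of_real x * exp (complex_of_real t) = of_real (1 + lam * (x * exp t))"
        by (simp add: exp_of_real mult.assoc)
      then show ?thesis using False elim
        by (simp only: h_def degenerate_exp_def if_False) (rule powr_of_real, simp)
    qed
    then show ?case by (simp add: g_def flip: of_real_inverse of_real_mult)
  qed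
  with R have E: "?f has_fps_expansion Abs_fps (\<lambda>n. Re (fps_nth (fps_expansion g 0) n))"
    by (simp add: has_fps_expansion_def) (auto elim: eventually_elim2)
  show ?thesis
  proof (rule ex1I)
    show "?f has_fps_expansion Abs_fps (\<lambda>n. (fact n * Re (fps_nth (fps_expansion g 0) n)) / fact n)"
      using E by simp
  next
    fix B assume "?f has_fps_expansion Abs_fps (\<lambda>n. B n / fact n)"
    from has_fps_expansion_unique_real[OF this E]
    show "B = (\<lambda>n. fact n * Re (fps_nth (fps_expansion g 0) n))"
      by (auto simp: fps_eq_iff fun_eq_iff field_simps)
  qed
qed

end

(* With weights w k = (1)_{k,lam} \<alpha>^k / k!, the expansion of e_lam at \<alpha> e^t reads
   e_lam (\<alpha> e^t) = \<Sum>k. w k e^(k t); expanding e^(k t) and exchanging the sums gives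
   e_lam \<alpha> * Bel_n \<alpha> = \<Sum>k. w k k^n, and E[X^n] is the tail k > r of this series over the
   normalising constant.  The exchange needs the expansion to converge slightly beyond \<alpha>;
   this holds since a nonnegative mass function forces lam = 0, 1 / lam a positive integer, or
   lam < 0, and in the last case the series diverges on and beyond the boundary of its disc. *)
theory Submission
  imports Defs
begin

section \<open>Expectations of functions of a variable with values in the naturals\<close>

text \<open>A measure on a countable space is determined by its singletons, so the law of
  \<open>X\<close> is a density with respect to counting measure. Both claims thus become claims
  about an absolutely convergent series.\<close>

lemma (in finite_measure)
  fixes X :: "'a \<Rightarrow> nat" and f :: "nat \<Rightarrow> real"
  assumes X [measurable]: "X \<in> measurable M (count_space UNIV)"
    and S: "summable (\<lambda>k. measure M {\<omega>\<in>space M. X \<omega> = k} * \<bar>f k\<bar>)"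
  shows integrable_nat_valued: "integrable M (\<lambda>\<omega>. f (X \<omega>))"
    and integral_nat_valued:
      "integral\<^sup>L M (\<lambda>\<omega>. f (X \<omega>)) = (\<Sum>k. measure M {\<omega>\<in>space M. X \<omega> = k} * f k)"
proof -
  let ?p = "\<lambda>k. measure M {\<omega>\<in>space M. X \<omega> = k}"
  let ?C = "count_space UNIV :: nat measure"
  have D: "distr M ?C X = density ?C ?p"
  proof (rule measure_eqI_countable[where A = UNIV])
    fix k :: nat
    have "emeasure (distr M ?C X) {k} = emeasure M (X -` {k} \<inter> space M)"
      by (rule emeasure_distr) auto
    also have "X -` {k} \<inter> space M = {\<omega>\<in>space M. X \<omega> = k}" by auto
    finally show "emeasure (distr M ?C X) {k} = emeasure (density ?C ?p) {k}"
      by (simp add: emeasure_density emeasure_eq_measure)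
  qed auto
  have I: "integrable ?C (\<lambda>k. ?p k *\<^sub>R f k)"
    using S by (simp add: integrable_count_space_nat_iff abs_mult)
  then have "integrable (distr M ?C X) f"
    unfolding D by (subst integrable_density) auto
  then show "integrable M (\<lambda>\<omega>. f (X \<omega>))"
    by (subst (asm) integrable_distr_eq) auto
  have "integral\<^sup>L M (\<lambda>\<omega>. f (X \<omega>)) = integral\<^sup>L (distr M ?C X) f"
    by (subst integral_distr) auto
  also have "\<dots> = integral\<^sup>L ?C (\<lambda>k. ?p k *\<^sub>R f k)"
    unfolding D by (subst integral_density) auto
  finally show "integral\<^sup>L M (\<lambda>\<omega>. f (X \<omega>)) = (\<Sum>k. ?p k * f k)"
    using integral_count_space_nat[OF I] by simp
qed

section \<open>Exponential generating function of the moments of a weight\<close>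

text \<open>Convergence at the single positive exponent \<epsilon> controls everything: it dominates
  all power moments, and for \<bar>t\<bar> < \<epsilon> it makes the double series of
  \<open>w k * (t * k) ^ n / n!\<close> absolutely summable, so that the order of summation may be
  exchanged.\<close>

lemma
  fixes w :: "nat \<Rightarrow> real"
  assumes nonneg: "\<And>k. w k \<ge> 0" and "\<epsilon> > 0"
    and S: "summable (\<lambda>k. w k * exp (\<epsilon> * real k))"
  shows summable_exp_weight_moment: "summable (\<lambda>k. w k * real k ^ n)"
    and exp_weight_has_fps_expansion:
      "(\<lambda>t. \<Sum>k. w k * exp (t * real k)) has_fps_expansion
         Abs_fps (\<lambda>n. (\<Sum>k. w k * real k ^ n) / fact n)"
proof -
  have mom: "summable (\<lambda>k. w k * real k ^ n)" for n
  proof (rule summable_comparison_test')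
    show "summable (\<lambda>k. fact n / \<epsilon> ^ n * (w k * exp (\<epsilon> * real k)))"
      by (rule summable_mult[OF S])
    fix k :: nat
    \<comment> \<open>The term of index \<open>n\<close> alone is at most the whole exponential
      series; this produces the constant \<open>fact n / \<epsilon> ^ n\<close>.\<close>
    have "(\<epsilon> * real k) ^ n / fact n \<le> exp (\<epsilon> * real k)"
    proof -
      have "(\<Sum>i\<in>{n}. (\<epsilon> * real k) ^ i /\<^sub>R fact i) \<le> (\<Sum>i. (\<epsilon> * real k) ^ i /\<^sub>R fact i)"
        using \<open>\<epsilon> > 0\<close> by (intro sum_le_suminf summable_exp_generic) auto
      then show ?thesis by (simp add: exp_def divide_inverse mult.commute)
    qed
    then have "real k ^ n \<le> fact n / \<epsilon> ^ n * exp (\<epsilon> * real k)"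
      using \<open>\<epsilon> > 0\<close> by (simp add: field_simps power_mult_distrib)
    from mult_left_mono[OF this nonneg[of k]]
    show "norm (w k * real k ^ n) \<le> fact n / \<epsilon> ^ n * (w k * exp (\<epsilon> * real k))"
      using nonneg[of k] by (simp add: mult_ac)
  qed
  then show "summable (\<lambda>k. w k * real k ^ n)" .
  define m where "m n = (\<Sum>k. w k * real k ^ n)" for n
  have main: "(\<lambda>n. m n / fact n * t ^ n) sums (\<Sum>k. w k * exp (t * real k))" if t: "\<bar>t\<bar> < \<epsilon>" for t
  proof -
    define F where "F k n = w k * (t * real k) ^ n / fact n" for k n
    have e: "(\<lambda>n. w k * s ^ n / fact n) sums (w k * exp s)" for k s
      using sums_mult[OF exp_converges[of s], of "w k"] by (simp add: field_simps)
    have nF: "norm (F k n) = w k * (\<bar>t\<bar> * real k) ^ n / fact n" for k n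
      using nonneg[of k] by (simp add: F_def abs_mult power_abs)
    \<comment> \<open>Summed over \<open>n\<close>, the absolute values give an exponential again,
      now at \<bar>t\<bar>; absolute summability over pairs thereby reduces to
      \<open>S\<close>.\<close>
    have inner: "((\<lambda>n. norm (F k n)) has_sum (w k * exp (\<bar>t\<bar> * real k))) UNIV" for k
      unfolding nF using nonneg[of k] e[of k "\<bar>t\<bar> * real k"]
      by (intro sums_nonneg_imp_has_sum) auto
    have Sexp: "summable (\<lambda>k. norm (w k * exp (s * real k)))" if "s \<le> \<epsilon>" for s
      using nonneg that
      by (intro summable_comparison_test'[OF S]) (auto intro!: mult_left_mono mult_right_mono)
    have "(\<lambda>k. norm (w k * exp (\<bar>t\<bar> * real k))) summable_on UNIV"
      using Sexp[of "\<bar>t\<bar>"] t by (intro norm_summable_imp_summable_on) auto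
    then have "(\<lambda>p. norm (case p of (k, n) \<Rightarrow> F k n)) summable_on UNIV \<times> UNIV"
      using inner by (subst Infinite_Sum.abs_summable_on_Sigma_iff)
        (auto simp: infsumI[OF inner, simplified] intro: has_sum_imp_summable)
    then have sF: "(\<lambda>(k, n). F k n) summable_on UNIV \<times> UNIV"
      by (rule abs_summable_summable)
    have "(\<lambda>(n, k). F k n) = (\<lambda>(k, n). F k n) \<circ> prod.swap"
      by (simp add: fun_eq_iff)
    \<comment> \<open>\<open>summable_on_Sigma_banach\<close> sums over the second component first,
      so the swapped family is what yields summability in \<open>n\<close> of the sums over
      \<open>k\<close>.\<close>
    with sF have sF': "(\<lambda>(n, k). F k n) summable_on UNIV \<times> UNIV"
      using summable_on_reindex[of prod.swap UNIV "\<lambda>(k, n). F k n"]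
      by simp
    have r: "infsum (F k) UNIV = w k * exp (t * real k)" for k
      using e[of k "t * real k"] has_sum_imp_summable[OF inner[of k]]
      by (intro infsumI norm_summable_imp_has_sum)
         (auto simp: F_def[abs_def] summable_on_UNIV_nonneg_real_iff)
    have c: "infsum (\<lambda>k. F k n) UNIV = m n / fact n * t ^ n" for n
    proof (intro infsumI norm_summable_imp_has_sum)
      show "summable (\<lambda>k. norm (F k n))"
        unfolding nF using summable_mult[OF mom[of n], of "\<bar>t\<bar> ^ n / fact n"]
        by (simp add: power_mult_distrib mult_ac)
      show "(\<lambda>k. F k n) sums (m n / fact n * t ^ n)"
        using sums_mult[OF summable_sums[OF mom[of n]], of "t ^ n / fact n"]
        by (simp add: F_def m_def power_mult_distrib mult_ac)
    qed
    have "(\<lambda>n. m n / fact n * t ^ n) summable_on UNIV"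
      using summable_on_Sigma_banach[OF sF'] by (simp add: c)
    then have "(\<lambda>n. m n / fact n * t ^ n) sums (\<Sum>\<^sub>\<infinity>n. m n / fact n * t ^ n)"
      by (intro has_sum_imp_sums has_sum_infsum)
    also have "(\<Sum>\<^sub>\<infinity>n. m n / fact n * t ^ n) = (\<Sum>\<^sub>\<infinity>k. w k * exp (t * real k))"
      using infsum_swap_banach[OF sF] by (simp add: c r)
    also have "\<dots> = (\<Sum>k. w k * exp (t * real k))"
      using Sexp[of t] t
      by (intro infsumI norm_summable_imp_has_sum summable_sums[OF summable_norm_cancel]) auto
    finally show ?thesis .
  qed
  let ?A = "Abs_fps (\<lambda>n. m n / fact n)"
  have "fps_conv_radius ?A \<ge> ereal \<epsilon>"
    unfolding fps_conv_radius_def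
    by (rule conv_radius_geI_ex') (use main in \<open>auto simp: sums_iff\<close>)
  then have "fps_conv_radius ?A > 0"
    using \<open>\<epsilon> > 0\<close> by (metis ereal_less(2) less_le_trans)
  moreover have "eventually (\<lambda>t. \<bar>t\<bar> < \<epsilon>) (nhds 0)"
    using \<open>\<epsilon> > 0\<close> by (auto simp: eventually_nhds_metric)
  then have "eventually (\<lambda>t. eval_fps ?A t = (\<Sum>k. w k * exp (t * real k))) (nhds 0)"
    by eventually_elim (use main in \<open>auto simp: eval_fps_def sums_iff\<close>)
  ultimately show "(\<lambda>t. \<Sum>k. w k * exp (t * real k)) has_fps_expansion
         Abs_fps (\<lambda>n. (\<Sum>k. w k * real k ^ n) / fact n)"
    by (simp add: has_fps_expansion_def m_def)
qed

section \<open>Degenerate factorials, the expansion of e_lam, and the admissible parameters\<close>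

lemma degenerate_ffact_Suc:
  "degenerate_ffact lam x (Suc k) = degenerate_ffact lam x k * (x - real k * lam)"
  by (simp add: degenerate_ffact_def)

lemma degenerate_ffact_1_conv_gbinomial:
  assumes "lam \<noteq> 0"
  shows "degenerate_ffact lam 1 k = (1 / lam gchoose k) * lam ^ k * fact k"
proof -
  have "degenerate_ffact lam 1 k = (\<Prod>i<k. lam * (1 / lam - real i))"
    using assms by (auto simp: degenerate_ffact_def field_simps intro!: prod.cong)
  also have "\<dots> = lam ^ k * (\<Prod>i<k. 1 / lam - real i)"
    by (simp add: prod.distrib)
  finally show ?thesis by (simp add: gbinomial_prod_rev atLeast0LessThan)
qed

lemma degenerate_exp_sums:
  assumes "\<bar>lam * x\<bar> < 1"
  shows "(\<lambda>k. degenerate_ffact lam 1 k * x ^ k / fact k) sums degenerate_exp lam x"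
proof (cases "lam = 0")
  case True
  then show ?thesis
    using exp_converges[of x] by (simp add: degenerate_ffact_def degenerate_exp_def field_simps)
next
  case False
  then show ?thesis
    using gen_binomial_real[OF assms, of "1 / lam"]
    by (simp add: degenerate_ffact_1_conv_gbinomial degenerate_exp_def power_mult_distrib mult_ac)
qed

text \<open>The binomial coefficients vanish beyond \<open>N\<close>, so the series is a finite
  binomial sum and its validity is not confined to the disc \<bar>lam * x\<bar> < 1. Positivity of
  \<open>1 + lam * x\<close> lets \<open>powr\<close> agree with the \<open>N\<close>-th
  power.\<close>

lemma degenerate_exp_sums_inverse_nat:
  assumes "lam > 0" "1 / lam = real N" "1 + lam * x > 0"
  shows "(\<lambda>k. degenerate_ffact lam 1 k * x ^ k / fact k) sums degenerate_exp lam x"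
proof -
  have *: "degenerate_ffact lam 1 k * x ^ k / fact k = real (N choose k) * (lam * x) ^ k" for k
    using assms(1,2)
    by (simp add: degenerate_ffact_1_conv_gbinomial binomial_gbinomial power_mult_distrib mult_ac)
  have "(\<lambda>k. real (N choose k) * (lam * x) ^ k) sums (\<Sum>k\<le>N. real (N choose k) * (lam * x) ^ k)"
    by (rule sums_finite) auto
  also have "(\<Sum>k\<le>N. real (N choose k) * (lam * x) ^ k) = (1 + lam * x) ^ N"
    using binomial_ring[of "lam * x" 1 N] by (simp add: add.commute)
  also have "\<dots> = degenerate_exp lam x"
    using assms by (simp add: degenerate_exp_def powr_realpow)
  finally show ?thesis by (simp only: *)
qed

text \<open>The terms \<open>a k\<close> of the series satisfy \<open>Suc k * a (Suc k) = (1 - k * lam) * x * a k \<ge> k * a k\<close>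
  when \<open>- lam * x \<ge> 1\<close>, so they dominate a multiple of the harmonic series.\<close>
lemma degenerate_exp_not_summable:
  assumes "x > 0" "lam * x \<le> - 1"
  shows "\<not> summable (\<lambda>k. degenerate_ffact lam 1 k * x ^ k / fact k)"
proof
  define a where "a k = degenerate_ffact lam 1 k * x ^ k / fact k" for k
  assume "summable (\<lambda>k. degenerate_ffact lam 1 k * x ^ k / fact k)"
  then have "summable a" by (simp add: a_def[abs_def])
  have step: "real (Suc k) * a (Suc k) = (1 - real k * lam) * x * a k" for k
    by (simp add: a_def degenerate_ffact_Suc del: of_nat_Suc)
  \<comment> \<open>The induction keeps \<open>Suc k * a (Suc k)\<close> at least \<open>x\<close>,
    starting from \<open>a 1 = x\<close>. The index is shifted because \<open>k * a k\<close> is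
    zero at \<open>k = 0\<close>.\<close>
  have ge: "a (Suc k) \<ge> x / real (Suc k)" for k
  proof (induction k)
    case 0
    show ?case by (simp add: a_def degenerate_ffact_def)
  next
    case (Suc k)
    have "x \<le> real (Suc k) * a (Suc k)"
      using Suc by (simp add: field_simps)
    also have "\<dots> \<le> (1 - real (Suc k) * lam) * x * a (Suc k)"
    proof (rule mult_right_mono)
      have "real (Suc k) * 1 \<le> real (Suc k) * (- (lam * x))"
        using assms(2) by (intro mult_left_mono) auto
      then show "real (Suc k) \<le> (1 - real (Suc k) * lam) * x"
        using assms(1) by (simp add: algebra_simps)
      show "0 \<le> a (Suc k)"
        using Suc assms(1) by (meson divide_nonneg_nonneg less_imp_le of_nat_0_le_iff order_trans)
    qed
    also have "\<dots> = real (Suc (Suc k)) * a (Suc (Suc k))"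
      by (simp only: step)
    finally show ?case by (simp add: field_simps)
  qed
  have "summable (\<lambda>k. a (Suc k))"
    using \<open>summable a\<close> by (simp add: summable_Suc_iff)
  then have "summable (\<lambda>k. x * inverse (real (Suc k)))"
    by (rule summable_comparison_test'[where N = 0]) (use assms(1) ge in \<open>auto simp: divide_inverse\<close>)
  then have "summable (\<lambda>k. inverse (real (Suc k)))"
    using assms(1) by (simp only: summable_cmult_iff) auto
  then have "summable (\<lambda>k. inverse (real k))"
    by (subst (asm) summable_Suc_iff)
  then show False using not_summable_harmonic[where 'a = real] by simp
qed

text \<open>If \<open>1 / lam\<close> were positive but not an integer, the factors \<open>1 - k * lam\<close> would make
  the mass function change sign from one term to the next for \<open>k > 1 / lam\<close>.\<close>
lemma trunc_degenerate_poisson_rv_cases: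
  assumes "\<alpha> > 0" and rv: "trunc_degenerate_poisson_rv M X lam r \<alpha>"
  obtains (zero) "lam = 0"
    | (positive) N where "lam > 0" "1 / lam = real N"
    | (negative) "lam < 0" "- lam * \<alpha> < 1"
proof -
  consider "lam = 0" | "lam > 0" | "lam < 0" by linarith
  then show thesis
  proof cases
    case 1
    then show ?thesis by (rule zero)
  next
    case 3
    from rv have "summable (\<lambda>k. degenerate_ffact lam 1 k * \<alpha> ^ k / fact k)"
      by (auto simp: trunc_degenerate_poisson_rv_def sums_iff)
    with degenerate_exp_not_summable[OF \<open>\<alpha> > 0\<close>, of lam] have "\<not> lam * \<alpha> \<le> - 1" by blast
    with 3 show ?thesis by (intro negative) auto
  next
    case 2
    have "\<exists>N. 1 / lam = real N"
    proof (rule ccontr)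
      assume no: "\<not> ?thesis"
      have nz: "1 - real i * lam \<noteq> 0" for i
        using no 2 by (metis eq_iff_diff_eq_0 less_numeral_extra(3) nonzero_mult_div_cancel_right)
      define D where "D = degenerate_exp lam \<alpha> - degenerate_exp_trunc lam r \<alpha>"
      have D: "D \<noteq> 0" and mass: "\<And>k. k \<ge> r + 1 \<Longrightarrow> degenerate_ffact lam 1 k / D * (\<alpha> ^ k / fact k) \<ge> 0"
        using rv by (auto simp: trunc_degenerate_poisson_rv_def trunc_degenerate_poisson_mass_def D_def)
      \<comment> \<open>The sign of \<open>D\<close> is not known here, so the sign change is
        tracked in the quotient by \<open>D\<close>.\<close>
      have nonneg: "degenerate_ffact lam 1 k / D \<ge> 0" if "k \<ge> r + 1" for k
        by (rule mult_right_le_imp_le[of _ "\<alpha> ^ k / fact k"]) (use mass[OF that] \<open>\<alpha> > 0\<close> in auto)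
      obtain k0 where k0: "1 / lam < real k0" using reals_Archimedean2 by blast
      \<comment> \<open>Beyond \<open>1 / lam\<close> the next factor is negative; beyond
        \<open>r\<close> the mass condition applies to both \<open>k\<close> and
        \<open>Suc k\<close>.\<close>
      define k where "k = max k0 (r + 1)"
      have "1 / lam < real k" using k0 by (simp add: k_def)
      then have neg: "1 - real k * lam < 0" using 2 by (simp add: field_simps)
      have "degenerate_ffact lam 1 k \<noteq> 0"
        using nz by (simp add: degenerate_ffact_def)
      then have "degenerate_ffact lam 1 k / D > 0"
        using nonneg[of k] D by (simp add: k_def less_le)
      then have "degenerate_ffact lam 1 k / D * (1 - real k * lam) < 0"
        using neg by (rule mult_pos_neg)
      moreover have "degenerate_ffact lam 1 (Suc k) / D \<ge> 0"
        by (rule nonneg) (simp add: k_def)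
      ultimately show False by (simp add: degenerate_ffact_Suc)
    qed
    with 2 positive show ?thesis by blast
  qed
qed

text \<open>The mass condition speaks only of indices above \<open>r\<close>, and only relative to
  the normalising constant. The classification of parameters gives nonnegative weights at every
  index, as the exchange of sums requires: for \<open>lam\<close> \<le> 0 all factors are
  nonnegative, otherwise an ordinary binomial coefficient appears.\<close>

lemma degenerate_ffact_1_nonneg:
  assumes "lam \<le> 0 \<or> 1 / lam = real N"
  shows "degenerate_ffact lam 1 k \<ge> 0"
proof (cases "lam \<le> 0")
  case True
  then show ?thesis
    unfolding degenerate_ffact_def
    by (intro prod_nonneg) (auto simp: mult_nonneg_nonpos intro: order_trans[of _ 0])
next
  case False
  then show ?thesis
    using degenerate_ffact_1_conv_gbinomial[of lam k] assms
    by (simp add: binomial_gbinomial[symmetric])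
qed

text \<open>Extracts what the analysis needs from the three parameter cases, above all some room
  \<epsilon> around \<open>t = 0\<close> in which the expansion at \<open>\<alpha> * exp t\<close>
  stays valid.\<close>

lemma trunc_degenerate_poisson_rv_regular:
  assumes "\<alpha> > 0" and rv: "trunc_degenerate_poisson_rv M X lam r \<alpha>"
  obtains \<epsilon> where "\<epsilon> > 0" "1 + lam * \<alpha> > 0" "\<And>k. degenerate_ffact lam 1 k \<ge> 0"
    "\<And>t. \<bar>t\<bar> \<le> \<epsilon> \<Longrightarrow> (\<lambda>k. degenerate_ffact lam 1 k * (\<alpha> * exp t) ^ k / fact k)
        sums degenerate_exp lam (\<alpha> * exp t)"
proof (cases rule: trunc_degenerate_poisson_rv_cases[OF assms])
  case 1
  \<comment> \<open>For \<open>lam = 0\<close> the expansion holds everywhere, so 1 is an arbitrary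
    choice; likewise in the next case, where \<open>1 + lam * (\<alpha> * exp t)\<close> is positive
    for all \<open>t\<close>.\<close>
  show ?thesis
    by (rule that[of 1]) (use 1 in \<open>auto intro: degenerate_exp_sums degenerate_ffact_1_nonneg\<close>)
next
  case (2 N)
  have pos: "1 + lam * (\<alpha> * exp t) > 0" for t
    using 2 \<open>\<alpha> > 0\<close> by (intro add_pos_pos mult_pos_pos) auto
  show ?thesis
    by (rule that[of 1])
       (use 2 pos pos[of 0] in \<open>auto intro: degenerate_exp_sums_inverse_nat degenerate_ffact_1_nonneg\<close>)
next
  case 3
  \<comment> \<open>The point \<open>\<alpha> * exp t\<close> reaches the boundary of the disc at
    \<open>t = - ln (- lam * \<alpha>)\<close>. Half that distance keeps the closed interval
    \<bar>t\<bar> \<le> \<epsilon> strictly inside.\<close>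
  define \<epsilon> where "\<epsilon> = - ln (- lam * \<alpha>) / 2"
  have pos: "- lam * \<alpha> > 0" using 3 \<open>\<alpha> > 0\<close> by (simp add: mult_neg_pos)
  have "\<epsilon> > 0" using 3 pos by (simp add: \<epsilon>_def)
  have "\<bar>lam * (\<alpha> * exp t)\<bar> < 1" if "\<bar>t\<bar> \<le> \<epsilon>" for t
  proof -
    have "ln (- lam * \<alpha>) + t < 0" using that \<open>\<epsilon> > 0\<close> by (simp add: \<epsilon>_def)
    then have "exp (ln (- lam * \<alpha>) + t) < 1" by simp
    then have "- lam * \<alpha> * exp t < 1" by (simp only: exp_add exp_ln[OF pos])
    moreover have "\<bar>lam * (\<alpha> * exp t)\<bar> = - lam * \<alpha> * exp t"
      using 3 \<open>\<alpha> > 0\<close> by (simp add: abs_mult)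
    ultimately show ?thesis by simp
  qed
  then show ?thesis
    by (intro that[of \<epsilon>])
       (use 3 \<open>\<epsilon> > 0\<close> in \<open>auto intro: degenerate_exp_sums degenerate_ffact_1_nonneg\<close>)
qed

section \<open>Degenerate Bell polynomials as normalised moments\<close>

text \<open>At \<open>x * exp t\<close> the powers become \<open>x ^ k * exp (t * k)\<close>, so the
  generating function is an exponential sum whose Taylor coefficients are moments; uniqueness of the
  expansion identifies them with the Bell values.\<close>

lemma
  assumes "x > 0" "\<epsilon> > 0" and pos: "1 + lam * x > 0"
    and nonneg: "\<And>k. degenerate_ffact lam 1 k \<ge> 0"
    and exp: "\<And>t. \<bar>t\<bar> \<le> \<epsilon> \<Longrightarrow> (\<lambda>k. degenerate_ffact lam 1 k * (x * exp t) ^ k / fact k)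
        sums degenerate_exp lam (x * exp t)"
  shows summable_degenerate_moment:
      "summable (\<lambda>k. degenerate_ffact lam 1 k * x ^ k / fact k * real k ^ n)"
    and degenerate_bell_eq_suminf:
      "degenerate_bell lam n x = inverse (degenerate_exp lam x) *
         (\<Sum>k. degenerate_ffact lam 1 k * x ^ k / fact k * real k ^ n)"
proof -
  define w where "w k = degenerate_ffact lam 1 k * x ^ k / fact k" for k
  have w: "w k \<ge> 0" for k using nonneg \<open>x > 0\<close> by (simp add: w_def)
  have E: "(\<lambda>k. w k * exp (t * real k)) sums degenerate_exp lam (x * exp t)" if "\<bar>t\<bar> \<le> \<epsilon>" for t
    using exp[OF that]
    by (simp add: w_def power_mult_distrib exp_of_nat_mult[symmetric] mult_ac)
  have S: "summable (\<lambda>k. w k * exp (\<epsilon> * real k))"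
    using E[of \<epsilon>] \<open>\<epsilon> > 0\<close> by (simp add: sums_iff)
  show "summable (\<lambda>k. degenerate_ffact lam 1 k * x ^ k / fact k * real k ^ n)"
    using summable_exp_weight_moment[OF w \<open>\<epsilon> > 0\<close> S] by (simp add: w_def)
  let ?c = "inverse (degenerate_exp lam x)"
  let ?B = "\<lambda>n. ?c * (\<Sum>k. w k * real k ^ n)"
  have "(\<lambda>t. ?c * (\<Sum>k. w k * exp (t * real k))) has_fps_expansion
      fps_const ?c * Abs_fps (\<lambda>n. (\<Sum>k. w k * real k ^ n) / fact n)"
    by (intro fps_expansion_intros exp_weight_has_fps_expansion[OF w \<open>\<epsilon> > 0\<close> S])
  also have "fps_const ?c * Abs_fps (\<lambda>n. (\<Sum>k. w k * real k ^ n) / fact n) =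
      Abs_fps (\<lambda>n. ?B n / fact n)"
    by (simp add: fps_eq_iff)
  finally have "(\<lambda>t. ?c * (\<Sum>k. w k * exp (t * real k))) has_fps_expansion
      Abs_fps (\<lambda>n. ?B n / fact n)" .
  \<comment> \<open>A power series expansion depends only on the function near 0, so agreement for
    \<bar>t\<bar> \<le> \<epsilon> is enough to replace the sum by the closed form.\<close>
  moreover have "eventually (\<lambda>t. \<bar>t\<bar> \<le> \<epsilon>) (nhds 0)"
    using \<open>\<epsilon> > 0\<close> by (auto simp: eventually_nhds_metric)
  then have "eventually (\<lambda>t. ?c * (\<Sum>k. w k * exp (t * real k)) =
      ?c * degenerate_exp lam (x * exp t)) (nhds 0)"
    by eventually_elim (use E in \<open>simp add: sums_iff\<close>)
  ultimately have "(\<lambda>t. ?c * degenerate_exp lam (x * exp t)) has_fps_expansion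
      Abs_fps (\<lambda>n. ?B n / fact n)"
    by (subst (asm) has_fps_expansion_cong[OF _ refl])
  \<comment> \<open>Unique existence, available because \<open>1 + lam * x > 0\<close>, is what lets
    the definite description be evaluated.\<close>
  then have "(THE B. (\<lambda>t. ?c * degenerate_exp lam (x * exp t)) has_fps_expansion
      Abs_fps (\<lambda>n. B n / fact n)) = ?B"
    by (rule the1_equality[OF degenerate_bell_ex1[OF pos]])
  then show "degenerate_bell lam n x = ?c *
         (\<Sum>k. degenerate_ffact lam 1 k * x ^ k / fact k * real k ^ n)"
    by (simp add: degenerate_bell_def w_def)
qed

section \<open>The moment formula\<close>

theorem theorem3:
  fixes \<alpha> lam :: real and r n :: nat and M :: "'a measure" and X :: "'a \<Rightarrow> nat"
  assumes "\<alpha> > 0"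
    and "prob_space M"
    and "trunc_degenerate_poisson_rv M X lam r \<alpha>"
  shows "integrable M (\<lambda>\<omega>. real (X \<omega>) ^ n) \<and>
    prob_space.expectation M (\<lambda>\<omega>. real (X \<omega>) ^ n) =
      degenerate_exp lam \<alpha> / (degenerate_exp lam \<alpha> - degenerate_exp_trunc lam r \<alpha>) *
        (degenerate_bell lam n \<alpha> -
          inverse (degenerate_exp lam \<alpha>) *
            (\<Sum>m=0..r. \<alpha> ^ m / fact m * degenerate_ffact lam 1 m * real m ^ n))"
proof -
  interpret prob_space M by fact
  obtain \<epsilon> where reg: "\<epsilon> > 0" "1 + lam * \<alpha> > 0" "\<And>k. degenerate_ffact lam 1 k \<ge> 0"
    "\<And>t. \<bar>t\<bar> \<le> \<epsilon> \<Longrightarrow> (\<lambda>k. degenerate_ffact lam 1 k * (\<alpha> * exp t) ^ k / fact k)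
        sums degenerate_exp lam (\<alpha> * exp t)"
    using trunc_degenerate_poisson_rv_regular[OF assms(1,3)] by blast
  define D where "D = degenerate_exp lam \<alpha> - degenerate_exp_trunc lam r \<alpha>"
  \<comment> \<open>For \<open>n = 0\<close> the term at \<open>k = 0\<close> equals 1, in
    accordance with \<open>0 ^ 0 = 1\<close>.\<close>
  define v where "v k = degenerate_ffact lam 1 k * \<alpha> ^ k / fact k * real k ^ n" for k
  define p where "p k = measure M {\<omega>\<in>space M. X \<omega> = k}" for k
  have X: "X \<in> measurable M (count_space UNIV)"
    using assms(3) by (simp add: trunc_degenerate_poisson_rv_def)
  \<comment> \<open>Up to \<open>r\<close> the mass formula says nothing; there the probability is 0
    because \<open>X\<close> takes only values above \<open>r\<close>.\<close>
  have p: "p k * real k ^ n = (if k \<le> r then 0 else v k / D)" for k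
  proof (cases "k \<le> r")
    case True
    then have "{\<omega>\<in>space M. X \<omega> = k} = {}"
      using assms(3) by (force simp: trunc_degenerate_poisson_rv_def)
    with True show ?thesis by (simp only: p_def) simp
  next
    case False
    then show ?thesis
      using assms(3) by (simp add: p_def trunc_degenerate_poisson_rv_def
          trunc_degenerate_poisson_mass_def v_def D_def)
  qed
  have v: "summable v"
    using summable_degenerate_moment[OF assms(1) reg] by (simp add: v_def[abs_def])
  \<comment> \<open>The tail above \<open>r\<close> is written as the full series minus its first
    \<open>r + 1\<close> terms, which become the Bell term and the finite correction.\<close>
  have "(\<lambda>k. (v k - (if k \<in> {0..r} then v k else 0)) / D) sums (((\<Sum>k. v k) - (\<Sum>k=0..r. v k)) / D)"
    by (intro sums_divide sums_diff summable_sums[OF v] sums_If_finite_set) simp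
  also have "(\<lambda>k. (v k - (if k \<in> {0..r} then v k else 0)) / D) = (\<lambda>k. p k * real k ^ n)"
    by (auto simp: p)
  finally have sums: "(\<lambda>k. p k * real k ^ n) sums (((\<Sum>k. v k) - (\<Sum>k=0..r. v k)) / D)" .
  then have S: "summable (\<lambda>k. measure M {\<omega>\<in>space M. X \<omega> = k} * \<bar>real k ^ n\<bar>)"
    by (simp add: p_def sums_iff)
  have e: "degenerate_exp lam \<alpha> \<noteq> 0"
    using reg(2) by (simp add: degenerate_exp_def)
  have "expectation (\<lambda>\<omega>. real (X \<omega>) ^ n) = ((\<Sum>k. v k) - (\<Sum>k=0..r. v k)) / D"
    using integral_nat_valued[OF X S] sums by (simp add: p_def sums_iff)
  also have "(\<Sum>k. v k) = degenerate_exp lam \<alpha> * degenerate_bell lam n \<alpha>"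
    using degenerate_bell_eq_suminf[OF assms(1) reg, of n] e by (simp add: v_def)
  also have "(\<Sum>k=0..r. v k) = (\<Sum>m=0..r. \<alpha> ^ m / fact m * degenerate_ffact lam 1 m * real m ^ n)"
    by (simp add: v_def mult_ac)
  finally have "expectation (\<lambda>\<omega>. real (X \<omega>) ^ n) = (degenerate_exp lam \<alpha> * degenerate_bell lam n \<alpha> -
      (\<Sum>m=0..r. \<alpha> ^ m / fact m * degenerate_ffact lam 1 m * real m ^ n)) / D" .
  moreover have "degenerate_exp lam \<alpha> / D * (b - inverse (degenerate_exp lam \<alpha>) * s) =
      (degenerate_exp lam \<alpha> * b - s) / D" for b s
    using e by (simp add: right_diff_distrib diff_divide_distrib)
  ultimately show ?thesis
    using integrable_nat_valued[OF X S] by (simp only: D_def simp_thms)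
qed

end
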